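(* For every integer $n \ge 1$ and every $A \subset \{0,1\}^n$ with $\mu(A) \ge 1/2$, $$\mathbb{E}\, h_A^{0.53} \;\ge\; 2\,\mu(A)\,(1-\mu(A)).$$
   Context: The hypercube $\{0,1\}^n$ is regarded as a graph in which two vertices are adjacent iff they differ in exactly one coordinate. $\mu$ is the uniform probability measure on $\{0,1\}^n$ and $\mathbb{E}$ is expectation with respect to $\mu$. For $A \subset \{0,1\}^n$, $h_A:\{0,1\}^n \to \mathbb{R}$ is defined by $h_A(x)=0$ if $x \notin A$, and, if $x \in A$, $h_A(x)$ is the number of neighbours of $x$ lying in $A^c = \{0,1\}^n\setminus A$. *)

theory Defs
  imports "HOL-Probability.Probability"
begin

text \<open>The vertices of the \<open>n\<close>-dimensional hypercube are the extensional functions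
  from \<open>{..<n}\<close> to \<open>{0, 1}\<close>, so that equality of vertices is equality of coordinates.\<close>

definition hypercube :: "nat \<Rightarrow> (nat \<Rightarrow> nat) set" where
  "hypercube n = {..<n} \<rightarrow>\<^sub>E {0, 1}"

definition hypercube_adj :: "nat \<Rightarrow> (nat \<Rightarrow> nat) \<Rightarrow> (nat \<Rightarrow> nat) \<Rightarrow> bool" where
  "hypercube_adj n x y \<longleftrightarrow>
     x \<in> hypercube n \<and> y \<in> hypercube n \<and> card {i. i < n \<and> x i \<noteq> y i} = 1"

definition cube_measure :: "nat \<Rightarrow> (nat \<Rightarrow> nat) measure" where
  "cube_measure n = uniform_count_measure (hypercube n)"

definition boundary_degree :: "nat \<Rightarrow> (nat \<Rightarrow> nat) set \<Rightarrow> (nat \<Rightarrow> nat) \<Rightarrow> real" where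
  "boundary_degree n A x =
     (if x \<in> A then real (card {y \<in> hypercube n - A. hypercube_adj n x y}) else 0)"

end

theory Submission
  imports Defs
begin

text \<open>Replace \<open>h powr 0.53\<close> by the smaller \<open>w h = sqrt (1 + 27/25 * (h - 1))\<close>, \<open>w 0 = 0\<close>, and
  \<open>2 p (1 - p)\<close> by the cubic \<open>B p = 4/7 p (1 - p) (3 + p)\<close>, which dominates it for \<open>p \<ge> 1/2\<close>.
  The bound \<open>E (w h) \<ge> B \<mu>\<close> then holds for all sets, by induction on the dimension: split the set
  along the last coordinate into slices of measures \<open>x \<ge> y\<close>. On the larger slice the degree
  grows by one off the smaller slice, and an affine estimate \<open>w (h + 1) \<ge> a + c w h\<close>
  reduces the step to \<open>2 B ((x + y) / 2) \<le> B y + a (x - y) + c B x\<close> for a suitable \<open>(a, c)\<close>.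
  Since \<open>w (h + 1)\<^sup>2 = (w h)\<^sup>2 + 27/25\<close> for \<open>h \<ge> 1\<close>, the optimal tangent serves when
  \<open>x - y \<le> B x\<close>; the chord \<open>a = 1\<close> serves otherwise.\<close>

section \<open>A sequence below \<open>h powr 0.53\<close>\<close>

text \<open>27/25 lies just below \<open>2 powr 1.06 - 1\<close>, as the comparison at
  \<open>h = 2\<close> requires.\<close>

definition root_weight :: "nat \<Rightarrow> real" where
  "root_weight h = (if h = 0 then 0 else sqrt (1 + 27/25 * (real h - 1)))"

lemma root_weight_0 [simp]: "root_weight 0 = 0"
  by (simp add: root_weight_def)

lemma root_weight_1 [simp]: "root_weight (Suc 0) = 1"
  by (simp add: root_weight_def)

lemma root_weight_nonneg: "root_weight h \<ge> 0"
  by (simp add: root_weight_def)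

lemma root_weight_ge_1: "h \<ge> 1 \<Longrightarrow> root_weight h \<ge> 1"
  by (simp add: root_weight_def)

lemma root_weight_Suc: "h \<ge> 1 \<Longrightarrow> root_weight (Suc h) = sqrt ((root_weight h)\<^sup>2 + 27/25)"
  by (simp add: root_weight_def field_simps)

lemma root_weight_mono: "root_weight h \<le> root_weight (Suc h)"
  by (simp add: root_weight_def)

text \<open>Compare squares: both are 1 at \<open>h = 1\<close>; for \<open>h \<ge> 2\<close>,
  Bernoulli's inequality based at 2 bounds the convex \<open>h powr 1.06\<close> below by an affine
  function.\<close>

lemma root_weight_le_powr: "root_weight h \<le> real h powr (53/100)"
proof -
  consider "h = 0" | "h = 1" | "h \<ge> 2" by linarith
  then show ?thesis
  proof cases
    case 3
    define u where "u = (real h - 2) / 2"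
    have u: "u \<ge> 0" and h: "real h = 2 * (1 + u)" using 3 by (auto simp: u_def field_simps)
    have two: "(2::real) powr (53/50) \<ge> 52/25"
    proof -
      have "((52/25)::real) ^ 50 \<le> 2 ^ 53" by (simp add: power_divide)
      also have "(2::real) ^ 53 = 2 powr (53/50 * real 50)" by simp
      also have "\<dots> = (2 powr (53/50)) ^ 50"
        by (subst powr_realpow[symmetric]) (simp_all only: powr_powr, simp)
      finally show ?thesis by (subst (asm) power_mono_iff) auto
    qed
    have bern: "(1 + u) powr (53/50) \<ge> 1 + 53/50 * u"
    proof -
      \<comment> \<open>Bernoulli for a real exponent: Young's inequality with weights 50/53 and
        3/53, then inverted.\<close>
      have "(1 + 53/50 * u) powr (50/53) \<le> 1 + u"
        using Youngs_inequality_0[of "50/53" "3/53" "1 + 53/50 * u" 1] u by (simp add: field_simps)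
      then have "((1 + 53/50 * u) powr (50/53)) powr (53/50) \<le> (1 + u) powr (53/50)"
        by (intro powr_mono2) auto
      then show ?thesis using u by (simp add: powr_powr)
    qed
    have "1 + 27/25 * (real h - 1) \<le> 52/25 * (1 + 53/50 * u)"
      using u by (simp add: h field_simps)
    also have "\<dots> \<le> 2 powr (53/50) * (1 + u) powr (53/50)"
      using two bern u by (intro mult_mono) auto
    also have "\<dots> = real h powr (53/50)"
      using u by (simp add: h powr_mult del: distrib_left_numeral)
    also have "\<dots> = (real h powr (53/100))\<^sup>2"
      by (simp add: power2_eq_square flip: powr_add)
    finally have "sqrt (1 + 27/25 * (real h - 1)) \<le> real h powr (53/100)"
      by (intro real_le_lsqrt) auto
    with 3 show ?thesis by (simp add: root_weight_def)
  qed (auto simp: root_weight_def)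
qed

section \<open>Affine lower bounds for the effect of one extra neighbour\<close>

text \<open>In the induction \<open>a\<close> is gained at points of the larger slice outside the
  smaller one; \<open>c \<le> 1\<close> serves the points in both slices, whose degree is
  unchanged.\<close>

definition minorant :: "real \<Rightarrow> real \<Rightarrow> bool" where
  "minorant a c \<longleftrightarrow> 0 \<le> a \<and> 0 \<le> c \<and> c \<le> 1 \<and> (\<forall>h. a + c * root_weight h \<le> root_weight (Suc h))"

lemma minorant_trivial: "minorant 0 1"
  by (simp add: minorant_def root_weight_mono)

text \<open>The slope \<open>221/500\<close> is just below \<open>w 2 - w 1 = sqrt 2.08 - 1\<close>.\<close>

lemma minorant_chord: "minorant 1 (221/500)"
proof -
  have "1 + 221/500 * root_weight h \<le> root_weight (Suc h)" if "h \<ge> 1" for h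
  proof -
    define v where "v = root_weight h - 1"
    have v: "v \<ge> 0" "root_weight h = 1 + v" using root_weight_ge_1[OF that] by (auto simp: v_def)
    \<comment> \<open>This holds coefficientwise in \<open>v\<close>; the constant terms are
      2.079364 and 2.08.\<close>
    have "(1 + 221/500 * root_weight h)\<^sup>2 \<le> (root_weight h)\<^sup>2 + 27/25"
      using v mult_nonneg_nonneg[OF v(1) v(1)] by (simp add: power2_eq_square field_simps)
    then show ?thesis by (simp add: root_weight_Suc[OF that] real_le_rsqrt)
  qed
  then have "1 + 221/500 * root_weight h \<le> root_weight (Suc h)" for h
    by (cases h) auto
  then show ?thesis by (simp add: minorant_def)
qed

text \<open>Weighted Cauchy-Schwarz for \<open>h \<ge> 1\<close>; the bound \<open>a \<le> 1\<close>
  settles \<open>h = 0\<close>.\<close>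

lemma minorant_tangent:
  assumes "0 \<le> a" "a \<le> 1" "0 \<le> c" "25/27 * a\<^sup>2 + c\<^sup>2 \<le> 1"
  shows "minorant a c"
proof -
  have "a + c * root_weight h \<le> root_weight (Suc h)" if "h \<ge> 1" for h
  proof -
    let ?u = "root_weight h"
    \<comment> \<open>The added square is the defect in Lagrange's identity.\<close>
    have "(a + c * ?u)\<^sup>2 \<le> (a + c * ?u)\<^sup>2 + (25/27 * a * ?u - c)\<^sup>2 * (27/25)"
      by simp
    also have "(a + c * ?u)\<^sup>2 + (25/27 * a * ?u - c)\<^sup>2 * (27/25) = (25/27 * a\<^sup>2 + c\<^sup>2) * (?u\<^sup>2 + 27/25)"
      by (simp add: power2_eq_square field_simps)
    also have "\<dots> \<le> 1 * (?u\<^sup>2 + 27/25)"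
      using assms by (intro mult_right_mono) auto
    finally have "(a + c * ?u)\<^sup>2 \<le> ?u\<^sup>2 + 27/25" by simp
    then show ?thesis by (simp add: root_weight_Suc[OF that] real_le_rsqrt)
  qed
  moreover have "c \<le> 1"
  proof (rule power2_le_imp_le)
    show "c\<^sup>2 \<le> 1\<^sup>2" using assms(4) zero_le_power2[of a] unfolding one_power2 by linarith
  qed simp
  ultimately have "a + c * root_weight h \<le> root_weight (Suc h)" for h
    using assms by (cases h) auto
  with \<open>c \<le> 1\<close> assms show ?thesis by (simp add: minorant_def)
qed

section \<open>The two-point inequality\<close>

text \<open>The factor \<open>4/7 * (3 + p)\<close> is 2 at \<open>p = 1/2\<close>, so the cubic
  agrees there with \<open>2 * p * (1 - p)\<close>.\<close>

definition profile :: "real \<Rightarrow> real" where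
  "profile p = 4/7 * p * (1 - p) * (3 + p)"

lemma profile_nonneg: "0 \<le> p \<Longrightarrow> p \<le> 1 \<Longrightarrow> profile p \<ge> 0"
  by (simp add: profile_def)

text \<open>The exact second difference of the cubic; it cancels \<open>profile y\<close> from the
  two-point claim.\<close>

lemma profile_midpoint:
  "2 * profile ((x + y) / 2) = profile x + profile y + (x - y)\<^sup>2 * ((4 + 3 * (x + y)) / 7)"
  by (simp add: profile_def power2_eq_square field_simps)

text \<open>54/100 is half of 27/25, the limit that the tangent argument allows as
  \<open>x - y\<close> tends to 0.\<close>

lemma profile_bound_diagonal:
  assumes "0 \<le> x" "x \<le> 1"
  shows "profile x * ((4 + 6 * x) / 7) \<le> 54/100"
proof -
  \<comment> \<open>Division by the square of \<open>x - 623/1000\<close>, a root near the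
    maximiser; the linear remainder is positive on \<open>[0, 1]\<close>.\<close>
  have "378/100 - profile x * (4 + 6 * x) =
      (x - 623/1000)\<^sup>2 * (8461161/875000 + 11738/875 * x + 24/7 * x\<^sup>2)
      + (3354006033/125000000000 - 3312899/218750000 * x)"
    by (simp add: profile_def power2_eq_square field_simps)
  moreover have "0 \<le> (x - 623/1000)\<^sup>2 * (8461161/875000 + 11738/875 * x + 24/7 * x\<^sup>2)"
    using assms by (intro mult_nonneg_nonneg add_nonneg_nonneg) auto
  ultimately have "profile x * (4 + 6 * x) \<le> 378/100" using assms by linarith
  then show ?thesis by simp
qed

text \<open>This is the case \<open>x - y = profile x\<close>, where tangent and chord regimes meet;
  0.4415 is just below the chord slope 0.442.\<close>

lemma profile_bound_crossover:
  assumes "0 \<le> x" "x \<le> 1"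
  shows "profile x * ((4 + 6 * x - 3 * profile x) / 7) \<le> 4415/10000"
proof -
  \<comment> \<open>Replacing the square by its tangent at 47/100, near
    \<open>profile (33/50)\<close>, lowers the degree from 6 to 4.\<close>
  have "3 * (47/50 * profile x - (47/100)\<^sup>2) \<le> 3 * (profile x)\<^sup>2"
    using zero_le_power2[of "profile x - 47/100"] by (simp add: power2_eq_square algebra_simps)
  moreover have "7 * 4415/10000 - (profile x * (4 + 6 * x) - 3 * (47/50 * profile x - (47/100)\<^sup>2)) =
      (x - 33/50)\<^sup>2 * (3428/625 + 422/35 * x + 24/7 * x\<^sup>2)
      + (120691/3125000 - 7659/218750 * x)"
    by (simp add: profile_def power2_eq_square field_simps)
  moreover have "0 \<le> (x - 33/50)\<^sup>2 * (3428/625 + 422/35 * x + 24/7 * x\<^sup>2)"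
    using assms by (intro mult_nonneg_nonneg add_nonneg_nonneg) auto
  ultimately show ?thesis using assms by (simp add: power2_eq_square algebra_simps)
qed

text \<open>With \<open>t = (x - y) / B x\<close> the best tangent gives \<open>a (x - y) + c B x = B x * sqrt (1 + 27/25 t\<^sup>2)\<close>,
  so the claim is quadratic in \<open>p\<close> below; \<open>p\<close> is affine in \<open>t\<close>, hence controlled by its values at
  \<open>t = 0\<close> and \<open>t = 1\<close>, which are the two bounds above.\<close>

lemma two_point_near:
  assumes xy: "0 \<le> y" "y \<le> x" "x \<le> 1" and near: "x - y \<le> profile x" and "0 < profile x"
  shows "\<exists>a c. minorant a c \<and> 2 * profile ((x + y) / 2) \<le> profile y + a * (x - y) + c * profile x"
proof -
  define b where "b = profile x"
  define t where "t = (x - y) / b"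
  define p where "p = b * ((4 + 3 * (x + y)) / 7)"
  define s where "s = sqrt (1 + 27/25 * t\<^sup>2)"
  have b: "b > 0" using assms by (simp add: b_def)
  have t: "0 \<le> t" "t \<le> 1" using assms b by (auto simp: t_def b_def field_simps)
  have d: "x - y = t * b" using b by (simp add: t_def)
  have "p = (1 - t) * (b * ((4 + 6 * x) / 7)) + t * (b * ((4 + 6 * x - 3 * b) / 7))"
  proof -
    have "x = y + t * b" using d by simp
    then show ?thesis by (simp add: p_def field_simps)
  qed
  also have "\<dots> \<le> (1 - t) * (54/100) + t * (4415/10000)"
    using profile_bound_diagonal[of x] profile_bound_crossover[of x] xy t
    by (intro add_mono mult_left_mono) (auto simp: b_def)
  finally have p_le: "p \<le> 4415/10000 + 985/10000 * (1 - t)" by (simp add: field_simps)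
  have p0: "0 \<le> p" using b xy by (simp add: p_def)
  \<comment> \<open>Since \<open>2 * p \<le> 27/25 - t * (197/1000)\<close>, the quadratic bound
    follows once \<open>t * p\<^sup>2 \<le> 197/1000\<close>.\<close>
  have "p\<^sup>2 \<le> (4415/10000 + 985/10000 * (1 - t))\<^sup>2"
    using p_le p0 by (intro power_mono)
  then have "t * p\<^sup>2 \<le> t * (4415/10000 + 985/10000 * (1 - t))\<^sup>2"
    using t by (intro mult_left_mono)
  also have "\<dots> \<le> 197/1000"
  proof -
    define v where "v = 1 - t"
    have v: "0 \<le> v" "v \<le> 1" using t by (auto simp: v_def)
    \<comment> \<open>All coefficients in powers of \<open>v\<close> are nonnegative.\<close>
    have "197/1000 - (1 - v) * (4415/10000 + 985/10000 * v)\<^sup>2 =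
        (197/1000 - (4415/10000)\<^sup>2) + v * ((4415/10000)\<^sup>2 - 2 * (4415/10000) * (985/10000))
        + v\<^sup>2 * (2 * (4415/10000) * (985/10000) - (985/10000)\<^sup>2) + v^3 * (985/10000)\<^sup>2"
      by (simp add: power2_eq_square power3_eq_cube field_simps)
    also have "\<dots> \<ge> 0"
      using v by (intro add_nonneg_nonneg mult_nonneg_nonneg) (auto simp: power2_eq_square)
    finally show ?thesis by (simp add: v_def)
  qed
  finally have "t * (t * p\<^sup>2) \<le> t * (197/1000)"
    using t by (intro mult_left_mono)
  moreover have "2 * p \<le> 27/25 - t * (197/1000)" using p_le by (simp add: field_simps)
  ultimately have "2 * p + t * (t * p\<^sup>2) \<le> 27/25" by linarith
  then have quad: "2 * p + t\<^sup>2 * p\<^sup>2 \<le> 27/25" by (simp add: power2_eq_square mult.assoc)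
  have "(1 + t\<^sup>2 * p)\<^sup>2 = 1 + t\<^sup>2 * (2 * p + t\<^sup>2 * p\<^sup>2)"
    by (simp add: power2_eq_square algebra_simps)
  also have "\<dots> \<le> 1 + 27/25 * t\<^sup>2"
    using mult_left_mono[OF quad, of "t\<^sup>2"] by (simp add: algebra_simps)
  finally have s_ge: "1 + t\<^sup>2 * p \<le> s"
    by (simp add: s_def real_le_rsqrt)
  have s1: "s \<ge> 1" by (simp add: s_def)
  have s2: "s\<^sup>2 = 1 + 27/25 * t\<^sup>2" by (simp add: s_def add_nonneg_nonneg)
  \<comment> \<open>This pair gives equality in the constraint on \<open>(a, c)\<close>;
    \<open>t \<le> 1\<close> ensures \<open>a \<le> 1\<close>.\<close>
  have tang: "minorant (27/25 * t / s) (1 / s)"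
  proof (rule minorant_tangent)
    have "t\<^sup>2 \<le> 1" using t by (rule power_le_one)
    moreover have "(27/25 * t)\<^sup>2 = 729/625 * t\<^sup>2" by (simp add: power_mult_distrib power_divide)
    ultimately have "(27/25 * t)\<^sup>2 \<le> s\<^sup>2" unfolding s2 by linarith
    then have "27/25 * t \<le> s" by (rule power2_le_imp_le) (use s1 in simp)
    then show "27/25 * t / s \<le> 1" using s1 by simp
    have "25/27 * (27/25 * t / s)\<^sup>2 + (1 / s)\<^sup>2 = (1 + 27/25 * t\<^sup>2) / s\<^sup>2"
      by (simp add: power_mult_distrib power_divide add_divide_distrib)
    also have "\<dots> = 1" unfolding s2[symmetric] using s1 by simp
    finally show "25/27 * (27/25 * t / s)\<^sup>2 + (1 / s)\<^sup>2 \<le> 1" by simp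
  qed (use t s1 in auto)
  have "b + (x - y)\<^sup>2 * ((4 + 3 * (x + y)) / 7) = b * (1 + t\<^sup>2 * p)"
    by (simp add: d p_def power2_eq_square algebra_simps)
  also have "\<dots> \<le> b * s" using s_ge b by (intro mult_left_mono) auto
  also have "\<dots> = b * (s\<^sup>2 / s)" using s1 by (simp add: power2_eq_square)
  also have "\<dots> = 27/25 * t / s * (x - y) + 1 / s * b"
    unfolding s2 by (simp add: d power2_eq_square add_divide_distrib distrib_left mult_ac)
  finally have "2 * profile ((x + y) / 2) \<le> profile y + 27/25 * t / s * (x - y) + 1 / s * b"
    by (simp add: profile_midpoint b_def)
  with tang show ?thesis unfolding b_def by blast
qed

text \<open>With \<open>profile y\<close> cancelled, the claim is \<open>P d \<ge> 0\<close> for a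
  cubic \<open>P\<close> concave on \<open>[b, x]\<close>; the endpoints are the crossover
  \<open>d = b\<close> and \<open>y = 0\<close>.\<close>

lemma two_point_far:
  assumes xy: "0 \<le> y" "y \<le> x" "x \<le> 1" and far: "profile x < x - y"
  shows "2 * profile ((x + y) / 2) \<le> profile y + 1 * (x - y) + 221/500 * profile x"
proof -
  define b where "b = profile x"
  define d where "d = x - y"
  define P where "P = (\<lambda>d. d - 279/500 * b - d\<^sup>2 * ((4 + 3 * (2 * x - d)) / 7))"
  have b: "0 \<le> b" "b < d" using far xy by (auto simp: b_def d_def profile_nonneg)
  have d: "d \<le> x" using xy by (simp add: d_def)
  have Pb: "P b \<ge> 0"
  proof -
    have "P b = b * (221/500 - b * ((4 + 6 * x - 3 * b) / 7))"
      by (simp add: P_def power2_eq_square field_simps)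
    also have "\<dots> \<ge> 0"
      using profile_bound_crossover[of x] b xy by (intro mult_nonneg_nonneg) (auto simp: b_def)
    finally show ?thesis .
  qed
  have Px: "P x \<ge> 0"
  proof -
    have "P x = x * ((1 - x) * (1 + 3/7 * x - 279/500 * (4/7 * (3 + x))))"
      by (simp add: P_def b_def profile_def power2_eq_square field_simps)
    also have "\<dots> \<ge> 0"
      using xy by (intro mult_nonneg_nonneg) (auto simp: field_simps)
    finally show ?thesis .
  qed
  \<comment> \<open>\<open>P\<close> is concave on \<open>[b, x]\<close>: the last summand is its excess over linear interpolation.\<close>
  have "(x - b) * P d = (x - d) * P b + (d - b) * P x
      + (x - b) * ((d - b) * (x - d)) * ((4 + 3 * (x - b - d)) / 7)"
    by (simp add: P_def power2_eq_square field_simps)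
  also have "\<dots> \<ge> 0"
    using Pb Px b d xy
    by (intro add_nonneg_nonneg mult_nonneg_nonneg) (auto simp: d_def)
  finally have "P d \<ge> 0"
    using b d by (simp add: zero_le_mult_iff)
  then have "(x - y)\<^sup>2 * ((4 + 3 * (x + y)) / 7) \<le> (x - y) - 279/500 * b"
    by (simp add: P_def d_def)
  then show ?thesis by (simp add: profile_midpoint b_def)
qed

lemma two_point:
  assumes "0 \<le> y" "y \<le> x" "x \<le> 1"
  shows "\<exists>a c. minorant a c \<and> 2 * profile ((x + y) / 2) \<le> profile y + a * (x - y) + c * profile x"
proof -
  consider "profile x < x - y" | "x - y \<le> profile x" "0 < profile x" | "x = y"
    using profile_nonneg[of x] assms by linarith
  then show ?thesis
  proof cases
    case 1
    then show ?thesis using two_point_far[OF assms] minorant_chord by blast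
  next
    case 2
    then show ?thesis using two_point_near[OF assms] by blast
  next
    case 3
    then show ?thesis using minorant_trivial by (intro exI[of _ 0] exI[of _ 1]) simp
  qed
qed

section \<open>Induction on the dimension\<close>

lemma finite_hypercube [simp]: "finite (hypercube n)"
  by (simp add: hypercube_def finite_PiE)

lemma card_hypercube: "card (hypercube n) = 2 ^ n"
  by (simp add: hypercube_def card_PiE numeral_2_eq_2)

lemma flip_in_hypercube: "x \<in> hypercube n \<Longrightarrow> i < n \<Longrightarrow> x(i := 1 - x i) \<in> hypercube n"
  by (auto simp: hypercube_def PiE_iff extensional_def)

lemma hypercube_coord: "x \<in> hypercube n \<Longrightarrow> i < n \<Longrightarrow> x i = 0 \<or> x i = 1"
  by (auto simp: hypercube_def PiE_iff)

lemma hypercube_undefined: "x \<in> hypercube n \<Longrightarrow> i \<ge> n \<Longrightarrow> x i = undefined"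
  by (auto simp: hypercube_def PiE_iff extensional_def)

section \<open>Degrees counted by coordinate flips\<close>

definition flip_degree :: "nat \<Rightarrow> (nat \<Rightarrow> nat) set \<Rightarrow> (nat \<Rightarrow> nat) \<Rightarrow> nat" where
  "flip_degree n A x = card {i. i < n \<and> x(i := 1 - x i) \<notin> A}"

lemma boundary_degree_eq_flip_degree:
  assumes "A \<subseteq> hypercube n" "x \<in> A"
  shows "boundary_degree n A x = real (flip_degree n A x)"
proof -
  have x: "x \<in> hypercube n" using assms by auto
  have "{y \<in> hypercube n - A. hypercube_adj n x y} =
      (\<lambda>i. x(i := 1 - x i)) ` {i. i < n \<and> x(i := 1 - x i) \<notin> A}" (is "?L = ?R")
  proof
    show "?L \<subseteq> ?R"
    proof
      fix y assume y: "y \<in> ?L"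
      then have yc: "y \<in> hypercube n" and "card {i. i < n \<and> x i \<noteq> y i} = 1"
        by (auto simp: hypercube_adj_def)
      then obtain i where i: "{i. i < n \<and> x i \<noteq> y i} = {i}" by (auto simp: card_1_singleton_iff)
      then have "i < n" "x i \<noteq> y i" by blast+
      have off_i: "x j = y j" if "j < n" "j \<noteq> i" for j using i that by blast
      then have yi: "y i = 1 - x i"
        using hypercube_coord[OF x, of i] hypercube_coord[OF yc, of i] \<open>i < n\<close> \<open>x i \<noteq> y i\<close> by auto
      have "y = x(i := 1 - x i)"
      proof
        fix j
        show "y j = (x(i := 1 - x i)) j"
          using off_i[of j] yi hypercube_undefined[OF x, of j] hypercube_undefined[OF yc, of j]
          by (cases "j < n"; cases "j = i") simp_all
      qed
      with y \<open>i < n\<close> show "y \<in> ?R" by auto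
    qed
    show "?R \<subseteq> ?L"
    proof clarify
      fix i assume i: "i < n" "x(i := 1 - x i) \<notin> A"
      have "x i \<noteq> 1 - x i" using hypercube_coord[OF x i(1)] by auto
      then have "{j. j < n \<and> x j \<noteq> (x(i := 1 - x i)) j} = {i}" using i by auto
      then show "x(i := 1 - x i) \<in> hypercube n - A \<and> hypercube_adj n x (x(i := 1 - x i))"
        using i x flip_in_hypercube[OF x i(1)] by (simp add: hypercube_adj_def)
    qed
  qed
  moreover have "inj_on (\<lambda>i. x(i := 1 - x i)) {i. i < n \<and> x(i := 1 - x i) \<notin> A}"
  proof (rule inj_onI)
    fix i j assume i: "i \<in> {i. i < n \<and> x(i := 1 - x i) \<notin> A}"
      and eq: "x(i := 1 - x i) = x(j := 1 - x j)"
    show "i = j"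
      using hypercube_coord[OF x, of i] i fun_cong[OF eq, of i] by (auto split: if_splits)
  qed
  ultimately show ?thesis
    using assms by (simp add: boundary_degree_def flip_degree_def card_image)
qed

section \<open>Splitting along the last coordinate\<close>

definition slice :: "nat \<Rightarrow> (nat \<Rightarrow> nat) set \<Rightarrow> nat \<Rightarrow> (nat \<Rightarrow> nat) set" where
  "slice n A v = {x \<in> hypercube n. x(n := v) \<in> A}"

lemma slice_subset: "slice n A v \<subseteq> hypercube n"
  by (auto simp: slice_def)

lemma finite_slice [simp]: "finite (slice n A v)"
  using slice_subset finite_hypercube by (rule finite_subset)

lemma sum_slices:
  fixes g :: "(nat \<Rightarrow> nat) \<Rightarrow> 'b::comm_monoid_add"
  assumes "A \<subseteq> hypercube (Suc n)" "v \<in> {0, 1}"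
  shows "sum g A = (\<Sum>x\<in>slice n A v. g (x(n := v))) + (\<Sum>x\<in>slice n A (1 - v). g (x(n := 1 - v)))"
proof -
  have inj: "inj_on (\<lambda>x. x(n := w)) (slice n A w)" for w
  proof (rule inj_onI)
    fix x y assume xy: "x \<in> slice n A w" "y \<in> slice n A w" and eq: "x(n := w) = y(n := w)"
    \<comment> \<open>Points of a slice are \<open>undefined\<close> at \<open>n\<close>, so
      overwriting that coordinate loses nothing.\<close>
    have "x n = y n" using xy hypercube_undefined[of x n n] hypercube_undefined[of y n n] by (simp add: slice_def)
    with eq show "x = y" by (metis fun_upd_triv fun_upd_upd)
  qed
  have "A = (\<lambda>x. x(n := v)) ` slice n A v \<union> (\<lambda>x. x(n := 1 - v)) ` slice n A (1 - v)"
  proof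
    show "A \<subseteq> (\<lambda>x. x(n := v)) ` slice n A v \<union> (\<lambda>x. x(n := 1 - v)) ` slice n A (1 - v)"
    proof
      fix x assume x: "x \<in> A"
      define z where "z = x(n := undefined)"
      have xc: "x \<in> hypercube (Suc n)" using assms x by auto
      then have "z \<in> hypercube n"
        by (auto simp: z_def hypercube_def PiE_iff extensional_def)
      moreover have "x = z(n := x n)" by (simp add: z_def)
      moreover have "x n = v \<or> x n = 1 - v" using hypercube_coord[OF xc, of n] assms by auto
      ultimately show "x \<in> (\<lambda>x. x(n := v)) ` slice n A v \<union> (\<lambda>x. x(n := 1 - v)) ` slice n A (1 - v)"
        using x unfolding slice_def by (metis (mono_tags, lifting) UnI1 UnI2 image_eqI mem_Collect_eq)
    qed
  qed (auto simp: slice_def)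
  moreover have "(\<lambda>x. x(n := v)) ` slice n A v \<inter> (\<lambda>x. x(n := 1 - v)) ` slice n A (1 - v) = {}"
  proof -
    have "v \<noteq> 1 - v" using assms by auto
    then show ?thesis by (auto dest: fun_cong[of _ _ n])
  qed
  ultimately have "sum g A = sum g ((\<lambda>x. x(n := v)) ` slice n A v) + sum g ((\<lambda>x. x(n := 1 - v)) ` slice n A (1 - v))"
    by (metis sum.union_disjoint finite_imageI finite_slice)
  then show ?thesis by (simp add: sum.reindex[OF inj])
qed

text \<open>Flips below \<open>n\<close> stay within the slice; flipping \<open>n\<close> leaves
  \<open>A\<close> exactly when \<open>x\<close> is not in the opposite slice.\<close>

lemma flip_degree_slice:
  assumes "x \<in> slice n A v"
  shows "flip_degree (Suc n) A (x(n := v)) =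
    flip_degree n (slice n A v) x + (if x \<in> slice n A (1 - v) then 0 else 1)"
proof -
  have x: "x \<in> hypercube n" using assms by (simp add: slice_def)
  have "{i. i < Suc n \<and> (x(n := v))(i := 1 - (x(n := v)) i) \<notin> A} =
      {i. i < n \<and> x(i := 1 - x i) \<notin> slice n A v} \<union> (if x \<in> slice n A (1 - v) then {} else {n})"
    using x flip_in_hypercube[OF x]
    by (auto simp: slice_def less_Suc_eq fun_upd_twist)
  then show ?thesis by (simp add: flip_degree_def)
qed

text \<open>No lower bound on the measure is assumed, so the induction hypothesis applies to both
  slices.\<close>

theorem root_weight_isoperimetry:
  "A \<subseteq> hypercube n \<Longrightarrow> 2 ^ n * profile (card A / 2 ^ n) \<le> (\<Sum>x\<in>A. root_weight (flip_degree n A x))"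
proof (induction n arbitrary: A)
  case 0
  then have "card A \<le> 1" using card_mono[OF finite_hypercube, of A 0] by (simp add: card_hypercube)
  then have "card A = 0 \<or> card A = 1" by linarith
  then show ?case by (auto simp: profile_def intro!: sum_nonneg root_weight_nonneg)
next
  case (Suc n)
  obtain v where v: "v \<in> {0, 1::nat}" "card (slice n A (1 - v)) \<le> card (slice n A v)"
    by (metis diff_self_eq_0 diff_zero insertI1 insertI2 nat_le_linear)
  define X Y where "X = slice n A v" and "Y = slice n A (1 - v)"
  define x y where "x = card X / 2 ^ n" and "y = card Y / 2 ^ n"
  have vv: "1 - (1 - v) = v" using v by auto
  have fin: "finite X" "finite Y" by (simp_all add: X_def Y_def)
  have sub: "X \<subseteq> hypercube n" "Y \<subseteq> hypercube n" by (simp_all add: X_def Y_def slice_subset)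
  have "card A = card X + card Y"
    using sum_slices[OF Suc.prems v(1), of "\<lambda>_. 1::nat"] by (simp add: X_def Y_def)
  then have mid: "card A / 2 ^ Suc n = (x + y) / 2"
    by (simp add: x_def y_def field_simps)
  have "card X \<le> 2 ^ n" using card_mono[OF finite_hypercube sub(1)] by (simp add: card_hypercube)
  then have "real (card X) \<le> 2 ^ n" by (metis of_nat_le_iff of_nat_numeral of_nat_power)
  then have xy: "0 \<le> y" "y \<le> x" "x \<le> 1"
    using v(2) by (auto simp: x_def y_def X_def Y_def divide_right_mono)
  obtain a c where ac: "minorant a c"
    and main: "2 * profile ((x + y) / 2) \<le> profile y + a * (x - y) + c * profile x"
    using two_point[OF xy] by blast
  have "2 ^ Suc n * profile (card A / 2 ^ Suc n) = 2 ^ n * (2 * profile ((x + y) / 2))"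
    by (subst mid) simp
  also have "\<dots> \<le> 2 ^ n * (profile y + a * (x - y) + c * profile x)"
    using main by (intro mult_left_mono) auto
  also have "\<dots> = 2 ^ n * profile y + a * (real (card X) - real (card Y)) + c * (2 ^ n * profile x)"
    by (simp add: x_def y_def field_simps)
  also have "\<dots> \<le> (\<Sum>z\<in>Y. root_weight (flip_degree n Y z)) + a * real (card (X - Y))
      + c * (\<Sum>z\<in>X. root_weight (flip_degree n X z))"
  proof (intro add_mono mult_left_mono)
    \<comment> \<open>The slices need not be nested; this inequality suffices because
      \<open>a \<ge> 0\<close>.\<close>
    show "real (card X) - real (card Y) \<le> real (card (X - Y))"
      using diff_card_le_card_Diff[OF fin(2), of X] by linarith
  qed (use Suc.IH sub ac in \<open>auto simp: x_def y_def minorant_def\<close>)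
  also have "a * real (card (X - Y)) = (\<Sum>z\<in>X. if z \<in> Y then 0 else a)"
    using fin by (simp add: sum.If_cases Diff_eq Collect_neg_eq)
  also have "(\<Sum>z\<in>Y. root_weight (flip_degree n Y z)) + (\<Sum>z\<in>X. if z \<in> Y then 0 else a)
      + c * (\<Sum>z\<in>X. root_weight (flip_degree n X z)) =
      (\<Sum>z\<in>X. c * root_weight (flip_degree n X z) + (if z \<in> Y then 0 else a))
      + (\<Sum>z\<in>Y. root_weight (flip_degree n Y z))"
    by (simp add: sum.distrib sum_distrib_left)
  also have "\<dots> \<le> (\<Sum>z\<in>X. root_weight (flip_degree (Suc n) A (z(n := v))))
      + (\<Sum>z\<in>Y. root_weight (flip_degree (Suc n) A (z(n := 1 - v))))"
  proof (intro add_mono sum_mono)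
    fix z assume "z \<in> X"
    then have "flip_degree (Suc n) A (z(n := v)) = flip_degree n X z + (if z \<in> Y then 0 else 1)"
      unfolding X_def Y_def by (rule flip_degree_slice)
    then show "c * root_weight (flip_degree n X z) + (if z \<in> Y then 0 else a)
        \<le> root_weight (flip_degree (Suc n) A (z(n := v)))"
      using ac by (auto simp: minorant_def root_weight_nonneg mult_left_le_one_le add.commute)
  next
    fix z assume "z \<in> Y"
    then have "flip_degree (Suc n) A (z(n := 1 - v)) = flip_degree n Y z + (if z \<in> X then 0 else 1)"
      using flip_degree_slice[of z n A "1 - v"] by (simp only: X_def Y_def vv)
    then show "root_weight (flip_degree n Y z) \<le> root_weight (flip_degree (Suc n) A (z(n := 1 - v)))"
      by (simp add: root_weight_mono)
  qed
  also have "\<dots> = (\<Sum>z\<in>A. root_weight (flip_degree (Suc n) A z))"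
    unfolding X_def Y_def by (rule sum_slices[OF Suc.prems v(1), symmetric])
  finally show ?case .
qed

theorem corollary1p5:
  fixes n :: nat and A :: "(nat \<Rightarrow> nat) set"
  assumes "n \<ge> 1"
    and "A \<subseteq> hypercube n"
    and "measure (cube_measure n) A \<ge> 1 / 2"
  shows "(\<integral>x. boundary_degree n A x powr 0.53 \<partial>cube_measure n)
    \<ge> 2 * measure (cube_measure n) A * (1 - measure (cube_measure n) A)"
proof -
  define p where "p = measure (cube_measure n) A"
  have p: "p = card A / 2 ^ n"
    using assms by (simp add: p_def cube_measure_def measure_uniform_count_measure card_hypercube)
  have "card A \<le> 2 ^ n"
    using card_mono[OF finite_hypercube assms(2)] by (simp add: card_hypercube)
  then have "real (card A) \<le> 2 ^ n" by (metis of_nat_le_iff of_nat_numeral of_nat_power)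
  then have p_le: "p \<le> 1" by (simp add: p)
  have "2 * p * (1 - p) \<le> profile p"
  proof -
    \<comment> \<open>The last factor is where measure at least 1/2 enters.\<close>
    have "profile p - 2 * p * (1 - p) = 4/7 * p * (1 - p) * (p - 1/2)"
      by (simp add: profile_def field_simps)
    also have "\<dots> \<ge> 0" using assms(3) p_le by (intro mult_nonneg_nonneg) (auto simp: p_def)
    finally show ?thesis by simp
  qed
  also have "profile p \<le> (\<Sum>x\<in>A. root_weight (flip_degree n A x)) / 2 ^ n"
    using root_weight_isoperimetry[OF assms(2)] by (simp add: p field_simps)
  also have "\<dots> \<le> (\<Sum>x\<in>A. boundary_degree n A x powr 0.53) / 2 ^ n"
    using assms(2) by (intro divide_right_mono sum_mono)
      (auto simp: boundary_degree_eq_flip_degree root_weight_le_powr)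
  \<comment> \<open>Off \<open>A\<close> the terms vanish because
    \<open>0 powr 0.53 = 0\<close>.\<close>
  also have "(\<Sum>x\<in>A. boundary_degree n A x powr 0.53) = (\<Sum>x\<in>hypercube n. boundary_degree n A x powr 0.53)"
    using assms(2) by (intro sum.mono_neutral_left) (auto simp: boundary_degree_def)
  also have "\<dots> / 2 ^ n = (\<integral>x. boundary_degree n A x powr 0.53 \<partial>cube_measure n)"
    unfolding cube_measure_def
    by (subst integral_uniform_count_measure) (simp_all add: card_hypercube)
  finally show ?thesis by (simp add: p_def)
qed

end
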